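(* If the origin is not contained in the interior of $P$, then convergence of $S_r$ to $\mathcal{S}$ may not be finite even when $\rho(G)<1$ and $P$ is bounded. That is: there exist positive integers $n,m$ and $A\in\mathbb{R}^{m\times n}$, $b\in\mathbb{R}^m$, $G\in\mathbb{R}^{n\times n}$ such that $\rho(G)<1$, the polyhedron $P=\{x\in\mathbb{R}^n\mid Ax\le b\}$ is bounded, the origin is not in the interior of $P$, and $S_r\setminus\mathcal{S}\ne\emptyset$ for every positive integer $r$.
   Context: Here $\rho(G)$ is the spectral radius of $G$ (largest absolute value of its eigenvalues), $S_r:=\bigcap_{k=0}^{r}\{x\in\mathbb{R}^n \mid AG^kx\le b\}$ for $r\geq 0$, and $\mathcal{S}:=\bigcap_{k=0}^{\infty}\{x\in\mathbb{R}^n \mid AG^kx\le b\}$. Inequalities between vectors are entrywise. Convergence of $S_r$ to $\mathcal S$ is called not finite if $S_r\setminus\mathcal{S}\neq\emptyset$ for all positive integers $r$. *)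

theory Defs
  imports
    "HOL-Analysis.Abstract_Metric_Spaces"
    "HOL-Analysis.L2_Norm"
    "Jordan_Normal_Form.Spectral_Radius"
begin

(* The Euclidean metric on R^n = carrier_vec n. The dimension is an explicit argument because
   Metric_space requires symmetry also for vectors outside the carrier. *)
definition vec_dist :: "nat \<Rightarrow> real Matrix.vec \<Rightarrow> real Matrix.vec \<Rightarrow> real" where
  "vec_dist n x y = L2_set (\<lambda>i. vec_index x i - vec_index y i) {..<n}"

global_interpretation vec_metric: Metric_space "carrier_vec n" "vec_dist n" for n :: nat
proof
  fix x y z :: "real Matrix.vec"
  show "0 \<le> vec_dist n x y"
    by (simp add: vec_dist_def)
  show "vec_dist n x y = vec_dist n y x"
    by (simp add: vec_dist_def L2_set_def power2_commute)
  show "(vec_dist n x y = 0) = (x = y)"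
    if "x \<in> carrier_vec n" "y \<in> carrier_vec n"
    using that by (auto simp: vec_dist_def L2_set_eq_0_iff intro!: eq_vecI)
  show "vec_dist n x z \<le> vec_dist n x y + vec_dist n y z"
    using L2_set_triangle_ineq[of "\<lambda>i. vec_index x i - vec_index y i"
        "\<lambda>i. vec_index y i - vec_index z i" "{..<n}"]
    by (simp add: vec_dist_def)
qed

(* The order on vectors is entrywise. The dimension of the ambient space is that of the
   columns of A. *)
definition polyhedron :: "real mat \<Rightarrow> real Matrix.vec \<Rightarrow> real Matrix.vec set" where
  "polyhedron A b = {x \<in> carrier_vec (dim_col A). A *\<^sub>v x \<le> b}"

definition S_fin :: "real mat \<Rightarrow> real Matrix.vec \<Rightarrow> real mat \<Rightarrow> nat \<Rightarrow> real Matrix.vec set" where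
  "S_fin A b G r = (\<Inter>k\<in>{0..r}. polyhedron (A * G ^\<^sub>m k) b)"

definition S_inf :: "real mat \<Rightarrow> real Matrix.vec \<Rightarrow> real mat \<Rightarrow> real Matrix.vec set" where
  "S_inf A b G = (\<Inter>k. polyhedron (A * G ^\<^sub>m k) b)"

end

theory Submission
  imports Defs
begin

text \<open>
  The example lives in the plane. Take the triangle \<open>P = {(x, y). 0 \<le> y \<le> x \<le> 1}\<close>, which has the
  origin as a vertex, and the contraction \<open>G = diag(1/4, 1/2)\<close>. Both coordinates of an orbit tend
  to \<open>0\<close>, but the first one decays faster, so the direction of an orbit that starts in \<open>P\<close> with
  \<open>y > 0\<close> turns towards the \<open>y\<close>-axis, and the orbit leaves \<open>P\<close> across the edge \<open>y = x\<close>. How long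
  this takes depends on the starting slope: the condition \<open>G\<^sup>k (x, y) \<in> P\<close> contains \<open>2\<^sup>k y \<le> x\<close>
  (lemma \<open>mem_polyhedron_pow_iff\<close>), so the point \<open>(1, 1/2\<^sup>r)\<close> satisfies the constraints for
  \<open>k \<le> r\<close> and violates the one for \<open>k = r + 1\<close>. Hence \<open>S\<^sub>r\<close> is never equal to its limit, which is
  the segment \<open>0 \<le> x \<le> 1\<close>, \<open>y = 0\<close>.

  For a contraction and a bounded \<open>P\<close>, only an origin on the boundary of \<open>P\<close> allows such late
  escapes. If \<open>P\<close> contained a neighbourhood of \<open>0\<close>, all orbits from \<open>P\<close> would be trapped in it
  after a common number of steps; if the origin lay outside the closed set \<open>P\<close>, they would all have
  left \<open>P\<close> after a common number of steps.
\<close>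

(* Only vectors of explicit dimension are indexed below; the same dollar notation for vectors
   indexed by a type would make every term ambiguous. *)
unbundle no vec_syntax

lemma pow_mat_diag:
  fixes f :: "nat \<Rightarrow> 'a::comm_semiring_1"
  shows "mat_diag n f ^\<^sub>m k = mat_diag n (\<lambda>i. f i ^ k)"
proof (induction k)
  case 0
  show ?case
    by (simp add: mat_diag_def one_mat_def)
next
  case (Suc k)
  then show ?case
    by (simp add: mult.commute)
qed

lemma mat_diag_mult_vec:
  fixes f :: "nat \<Rightarrow> 'a::comm_semiring_1"
  assumes "v \<in> carrier_vec n"
  shows "mat_diag n f *\<^sub>v v = Matrix.vec n (\<lambda>i. f i * v $ i)"
proof (rule eq_vecI)
  fix i assume "i < dim_vec (Matrix.vec n (\<lambda>i. f i * v $ i))"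
  then have i: "i < n" by simp
  have "(mat_diag n f *\<^sub>v v) $ i = (\<Sum>j = 0..<n. (if i = j then f j else 0) * v $ j)"
    using i assms by (simp add: mat_diag_def scalar_prod_def)
  also have "\<dots> = (\<Sum>j = 0..<n. if i = j then f j * v $ j else 0)"
    by (rule sum.cong) auto
  finally show "(mat_diag n f *\<^sub>v v) $ i = Matrix.vec n (\<lambda>i. f i * v $ i) $ i"
    using i by simp
qed (simp add: mat_diag_def)

lemma spectrum_mat_diag_subset:
  fixes f :: "nat \<Rightarrow> 'a::field"
  shows "spectrum (mat_diag n f) \<subseteq> f ` {..<n}"
proof
  fix c assume "c \<in> spectrum (mat_diag n f)"
  then obtain v where v: "v \<in> carrier_vec n" "v \<noteq> 0\<^sub>v n" and "mat_diag n f *\<^sub>v v = c \<cdot>\<^sub>v v"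
    by (auto simp: spectrum_def eigenvalue_def eigenvector_def mat_diag_def)
  then have eq: "Matrix.vec n (\<lambda>i. f i * v $ i) = c \<cdot>\<^sub>v v"
    by (simp add: mat_diag_mult_vec)
  \<comment> \<open>Any nonzero entry of the eigenvector identifies the eigenvalue with a diagonal entry.\<close>
  obtain i where i: "i < n" "v $ i \<noteq> 0"
    using v by (metis carrier_vecD eq_vecI index_zero_vec)
  have "f i * v $ i = c * v $ i"
    using arg_cong[OF eq, of "\<lambda>w. w $ i"] i v by simp
  then show "c \<in> f ` {..<n}"
    using i by auto
qed

lemma spectral_radius_mat_diag_less:
  assumes "n > 0" and "\<And>i. i < n \<Longrightarrow> norm (f i) < c"
  shows "spectral_radius (mat_diag n f) < c"
proof -
  have "spectral_radius (mat_diag n f) \<in> norm ` spectrum (mat_diag n f)"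
    using spectral_radius_mem_max(1)[OF mat_diag_dim \<open>n > 0\<close>] .
  then show ?thesis
    using spectrum_mat_diag_subset[of n f] assms(2) by auto
qed

definition triangle_mat :: "real mat" where
  "triangle_mat = mat_of_rows_list 2 [[-1, 1], [1, 0], [0, -1]]"

definition triangle_rhs :: "real Matrix.vec" where
  "triangle_rhs = vec_of_list [0, 1, 0]"

definition contraction :: "real mat" where
  "contraction = mat_diag 2 (\<lambda>i. if i = 0 then 1/4 else 1/2)"

lemma triangle_mat_carrier: "triangle_mat \<in> carrier_mat 3 2"
  by (simp add: triangle_mat_def mat_of_rows_list_def numeral_3_eq_3)

lemma contraction_carrier: "contraction \<in> carrier_mat 2 2"
  by (simp add: contraction_def)

lemma mult_triangle_mat_le_iff:
  assumes "v \<in> carrier_vec 2"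
  shows "triangle_mat *\<^sub>v v \<le> triangle_rhs \<longleftrightarrow> v $ 1 \<le> v $ 0 \<and> v $ 0 \<le> 1 \<and> 0 \<le> v $ 1"
proof -
  have rows: "triangle_mat *\<^sub>v v = vec_of_list [v $ 1 - v $ 0, v $ 0, - v $ 1]" (is "_ = ?w")
  proof (rule eq_vecI)
    fix i assume "i < dim_vec ?w"
    then consider "i = 0" | "i = 1" | "i = 2"
      by fastforce
    then show "(triangle_mat *\<^sub>v v) $ i = ?w $ i"
      using assms
      by cases (simp_all add: triangle_mat_def mat_of_rows_list_def scalar_prod_def numeral_2_eq_2)
  qed (simp add: triangle_mat_def mat_of_rows_list_def)
  show ?thesis
    unfolding rows triangle_rhs_def less_eq_vec_def
    by (simp add: All_less_Suc conj_ac)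
qed

lemma mem_triangle_iff:
  "v \<in> polyhedron triangle_mat triangle_rhs \<longleftrightarrow>
    v \<in> carrier_vec 2 \<and> v $ 1 \<le> v $ 0 \<and> v $ 0 \<le> 1 \<and> 0 \<le> v $ 1"
  unfolding polyhedron_def carrier_matD(2)[OF triangle_mat_carrier] mem_Collect_eq
  using mult_triangle_mat_le_iff by blast

text \<open>
  The coordinates of \<open>G\<^sup>k v\<close> are \<open>v\<^sub>0 / 4\<^sup>k\<close> and \<open>v\<^sub>1 / 2\<^sup>k\<close>. Clearing denominators, the edge
  \<open>y \<le> x\<close> of the triangle turns into the side of a wedge at the origin, whose slope
  \<open>1 / 2\<^sup>k\<close> shrinks forever.
\<close>

lemma mem_polyhedron_pow_iff:
  assumes "v \<in> carrier_vec 2"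
  shows "v \<in> polyhedron (triangle_mat * contraction ^\<^sub>m k) triangle_rhs \<longleftrightarrow>
    2 ^ k * v $ 1 \<le> v $ 0 \<and> v $ 0 \<le> 4 ^ k \<and> 0 \<le> v $ 1"
proof -
  define w where "w = contraction ^\<^sub>m k *\<^sub>v v"
  have pow: "contraction ^\<^sub>m k \<in> carrier_mat 2 2"
    using contraction_carrier by simp
  have w: "w \<in> carrier_vec 2"
    unfolding w_def using pow assms by simp
  have w_index: "w $ 0 = v $ 0 / 4 ^ k" "w $ 1 = v $ 1 / 2 ^ k"
    using assms by (simp_all add: w_def contraction_def pow_mat_diag mat_diag_mult_vec power_divide)
  have "v \<in> polyhedron (triangle_mat * contraction ^\<^sub>m k) triangle_rhs \<longleftrightarrow>
      triangle_mat *\<^sub>v w \<le> triangle_rhs"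
    unfolding polyhedron_def w_def
    using assms carrier_matD(2)[OF pow] assoc_mult_mat_vec[OF triangle_mat_carrier pow assms]
    by (simp del: pow_mat_dim)
  also have "\<dots> \<longleftrightarrow> v $ 1 / 2 ^ k \<le> v $ 0 / 4 ^ k \<and> v $ 0 / 4 ^ k \<le> 1 \<and> 0 \<le> v $ 1 / 2 ^ k"
    unfolding mult_triangle_mat_le_iff[OF w] w_index ..
  also have "v $ 1 / 2 ^ k \<le> v $ 0 / 4 ^ k \<longleftrightarrow> 2 ^ k * v $ 1 \<le> v $ 0"
  proof -
    have "(4::real) ^ k = 2 ^ k * 2 ^ k"
      by (simp flip: power_mult_distrib)
    then show ?thesis
      by (simp add: field_simps)
  qed
  also have "v $ 0 / 4 ^ k \<le> 1 \<longleftrightarrow> v $ 0 \<le> 4 ^ k"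
    by simp
  also have "0 \<le> v $ 1 / 2 ^ k \<longleftrightarrow> 0 \<le> v $ 1"
    by (simp add: field_simps)
  finally show ?thesis .
qed

lemma spectral_radius_contraction:
  "spectral_radius (map_mat complex_of_real contraction) < 1"
proof -
  have "map_mat complex_of_real contraction = mat_diag 2 (\<lambda>i. if i = 0 then 1/4 else 1/2)"
    by (rule eq_matI) (auto simp: contraction_def mat_diag_def)
  then show ?thesis
    by (simp add: spectral_radius_mat_diag_less)
qed

lemma mbounded_triangle: "vec_metric.mbounded 2 (polyhedron triangle_mat triangle_rhs)"
proof -
  have "polyhedron triangle_mat triangle_rhs \<subseteq> vec_metric.mcball 2 (0\<^sub>v 2) 2"
  proof
    fix v assume "v \<in> polyhedron triangle_mat triangle_rhs"
    then have v: "v \<in> carrier_vec 2" "v $ 1 \<le> v $ 0" "v $ 0 \<le> 1" "0 \<le> v $ 1"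
      by (auto simp: mem_triangle_iff)
    have "vec_dist 2 (0\<^sub>v 2) v \<le> (\<Sum>i<2. \<bar>0\<^sub>v 2 $ i - v $ i\<bar>)"
      unfolding vec_dist_def by (rule L2_set_le_sum_abs)
    also have "\<dots> \<le> 2"
      using v by (simp add: numeral_2_eq_2)
    finally show "v \<in> vec_metric.mcball 2 (0\<^sub>v 2) 2"
      using v by simp
  qed
  then show ?thesis
    using vec_metric.mbounded_mcball vec_metric.mbounded_subset by blast
qed

lemma zero_notin_interior_triangle:
  "0\<^sub>v 2 \<notin> vec_metric.mtopology 2 interior_of polyhedron triangle_mat triangle_rhs"
proof
  assume "0\<^sub>v 2 \<in> vec_metric.mtopology 2 interior_of polyhedron triangle_mat triangle_rhs"
  then have "\<exists>e>0. vec_metric.mball 2 (0\<^sub>v 2) e \<subseteq> polyhedron triangle_mat triangle_rhs"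
    by (simp add: vec_metric.metric_interior_of)
  then obtain e where e: "e > 0"
    and ball: "vec_metric.mball 2 (0\<^sub>v 2) e \<subseteq> polyhedron triangle_mat triangle_rhs"
    by blast
  \<comment> \<open>The positive \<open>y\<close>-axis lies above the edge \<open>y = x\<close>.\<close>
  define v where "v = vec_of_list [0, e / 2]"
  have v: "v \<in> carrier_vec 2" "v $ 0 = 0" "v $ 1 = e / 2"
    by (simp_all add: v_def carrier_vecI)
  have "vec_dist 2 (0\<^sub>v 2) v \<le> (\<Sum>i<2. \<bar>0\<^sub>v 2 $ i - v $ i\<bar>)"
    unfolding vec_dist_def by (rule L2_set_le_sum_abs)
  also have "\<dots> < e"
    using e v by (simp add: numeral_2_eq_2)
  finally have "v \<in> vec_metric.mball 2 (0\<^sub>v 2) e"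
    using v by simp
  then show False
    using ball v e by (auto simp: mem_triangle_iff)
qed

text \<open>
  The point \<open>(1, 1/2\<^sup>r)\<close> lies on the sloping side of the wedge for \<open>k = r\<close>, hence inside all the
  wider ones before it, and the next wedge cuts it off.
\<close>

lemma S_fin_minus_S_inf_nonempty:
  "S_fin triangle_mat triangle_rhs contraction r - S_inf triangle_mat triangle_rhs contraction \<noteq> {}"
proof -
  define v :: "real Matrix.vec" where "v = vec_of_list [1, 1 / 2 ^ r]"
  have v: "v \<in> carrier_vec 2" "v $ 0 = 1" "v $ 1 = 1 / 2 ^ r"
    by (simp_all add: v_def carrier_vecI)
  have "v \<in> S_fin triangle_mat triangle_rhs contraction r"
    using v by (auto simp: S_fin_def mem_polyhedron_pow_iff power_increasing)
  moreover have "v \<notin> polyhedron (triangle_mat * contraction ^\<^sub>m Suc r) triangle_rhs"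
    unfolding mem_polyhedron_pow_iff[OF v(1)] using v by simp
  then have "v \<notin> S_inf triangle_mat triangle_rhs contraction"
    unfolding S_inf_def by blast
  ultimately show ?thesis
    by blast
qed

theorem proposition2p5:
  shows "\<exists>(n::nat) (m::nat) (A::real mat) (b::real Matrix.vec) (G::real mat).
    n > 0 \<and> m > 0 \<and>
    A \<in> carrier_mat m n \<and> b \<in> carrier_vec m \<and> G \<in> carrier_mat n n \<and>
    spectral_radius (map_mat complex_of_real G) < 1 \<and>
    vec_metric.mbounded n (polyhedron A b) \<and>
    0\<^sub>v n \<notin> vec_metric.mtopology n interior_of polyhedron A b \<and>
    (\<forall>r::nat. r > 0 \<longrightarrow> S_fin A b G r - S_inf A b G \<noteq> {})"
proof -
  have "triangle_rhs \<in> carrier_vec 3"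
    by (simp add: triangle_rhs_def carrier_vecI)
  then show ?thesis
    using triangle_mat_carrier contraction_carrier spectral_radius_contraction
      mbounded_triangle zero_notin_interior_triangle S_fin_minus_S_inf_nonempty
    by (intro exI[of _ 2] exI[of _ 3] exI[of _ triangle_mat] exI[of _ triangle_rhs]
        exI[of _ contraction]) simp
qed

end
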